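(* (Type safety for natural numbers) If $M$ is a term such that $\vdash M:\mathsf{nat}$ (in the empty typing context), then $M\twoheadrightarrow S^n\,0$ for some $n\ge 0$, where $S^n\,0$ denotes $S\,(S\,(\cdots(S\,0)\cdots))$ with $n$ occurrences of $S$.
   Context: Terms. Fix a countable set $\mathcal{E}$ of exception names and a set of term variables. Terms, taken up to $\alpha$-equivalence, are generated by $$M,N ::= x \mid \lambda x.M \mid M\,N \mid \mathtt{raise}\,\varepsilon \mid \mathtt{try}\ M\ \mathtt{with}\ \varepsilon\mapsto N \mid 0 \mid S \mid \mathtt{rec} \mid \mathtt{nil} \mid \mathtt{cons} \mid \mathtt{fold}$$ with $\varepsilon\in\mathcal{E}$; application associates to the left, and $\mathtt{try}$ does not bind $\varepsilon$. Regular values are the closed terms of one of the forms $\lambda x.M$, $0$, $S$, $S\,N$, $\mathtt{rec}$, $\mathtt{rec}\,M$, $\mathtt{rec}\,M\,N$, $\mathtt{nil}$, $\mathtt{cons}$, $\mathtt{cons}\,M$, $\mathtt{cons}\,M\,N$, $\mathtt{fold}$, $\mathtt{fold}\,M$, $\mathtt{fold}\,M\,N$ (with $M,N$ arbitrary terms). Reduction. The base rules are: (1) $(\lambda x.M)\,N \to M[x:=N]$; (2) $(\mathtt{raise}\,\varepsilon)\,M \to \mathtt{raise}\,\varepsilon$; (3) $\mathtt{try}\ (\mathtt{raise}\,\varepsilon)\ \mathtt{with}\ \varepsilon\mapsto N \to N$; (4) $\mathtt{try}\ (\mathtt{raise}\,\varepsilon')\ \mathtt{with}\ \varepsilon\mapsto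 N \to \mathtt{raise}\,\varepsilon'$ if $\varepsilon\neq\varepsilon'$; (5) $\mathtt{try}\ V\ \mathtt{with}\ \varepsilon\mapsto N \to V$ if $V$ is a regular value; (6) $\mathtt{rec}\,X\,Y\,0 \to X$; $\mathtt{rec}\,X\,Y\,(S\,N)\to Y\,N\,(\mathtt{rec}\,X\,Y\,N)$; $\mathtt{rec}\,X\,Y\,(\mathtt{raise}\,\varepsilon)\to\mathtt{raise}\,\varepsilon$; (7) $\mathtt{fold}\,X\,Y\,\mathtt{nil}\to X$; $\mathtt{fold}\,X\,Y\,(\mathtt{cons}\,E\,L)\to Y\,E\,L\,(\mathtt{fold}\,X\,Y\,L)$; $\mathtt{fold}\,X\,Y\,(\mathtt{raise}\,\varepsilon)\to\mathtt{raise}\,\varepsilon$. The reduction $\to$ is the closure of these rules under all term constructors (under $\lambda$, on both sides of an application, in the body and in the handler of $\mathtt{try}$), and $\twoheadrightarrow$ is the reflexive transitive closure of $\to$. Types. $A,B ::= \alpha \mid \mathsf{nat} \mid \mathsf{list}\,A \mid A\to B \mid \forall\alpha.A \mid A\uplus\Delta \mid A^{\Delta}$, where $\alpha$ is a type variable and $\Delta\subseteq\mathcal{E}$ is a finite set of exception names; types are taken up to $\alpha$-equivalence. The constructions $A\uplus\Delta$ ("union") and $A^\Delta$ ("corruption") are purely syntactic and bind tighter than $\to$ and $\forall$; $FV$ denotes free type variables. A typing context $\Gamma$ is a finite set of declarations $x_i:A_i$ with distinct variables. Subtyping $\le$ is inductively defined by the following rules (for all types and finite $\Delta,\Delta'$;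 $A\equiv B$ abbreviates the two rules $A\le B$ and $B\le A$): $A\le A$; if $A\le B$ and $B\le C$ then $A\le C$; if $A'\le A$ and $B\le B'$ then $A\to B\le A'\to B'$; if $A\le B$ and $\alpha\notin FV(A)$ then $A\le\forall\alpha.B$; $\forall\alpha.A\le A[\alpha:=B]$; if $\alpha\notin FV(A)$ then $\forall\alpha.(A\to B)\le A\to\forall\alpha.B$; $A\le A\uplus\Delta$; $A\uplus\Delta\le A^\Delta$; $A^{\emptyset}\le A$; if $A\le B$ then $A\uplus\Delta\le B\uplus\Delta$; $(A\to B)\uplus\Delta\le A\to(B\uplus\Delta)$; $\forall\alpha.(A^\Delta)\le(\forall\alpha.A)^\Delta$; $\forall\alpha.(A\uplus\Delta)\le(\forall\alpha.A)\uplus\Delta$; $\mathsf{list}\,(A^\Delta)\le(\mathsf{list}\,A)^\Delta$; if $A\le B$ then $\mathsf{list}\,A\le\mathsf{list}\,B$; $(A\uplus\Delta)\uplus\Delta'\equiv A\uplus(\Delta\cup\Delta')$; $(A^\Delta)^{\Delta'}\equiv A^{\Delta\cup\Delta'}$; $(A\uplus\Delta)^{\Delta'}\equiv(A^{\Delta'})\uplus\Delta$; $(A\to B)^\Delta\equiv A^\Delta\to B^\Delta$. Typing $\Gamma\vdash M:A$ is inductively defined by: $\Gamma\vdash x:A$ if $(x:A)\in\Gamma$; if $\Gamma,x:A\vdash M:B$ then $\Gamma\vdash\lambda x.M:A\to B$; if $\Gamma\vdash M:A\to B$ and $\Gamma\vdash N:A$ then $\Gamma\vdash M\,N:B$; if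 $\Gamma\vdash M:A$ and $\alpha\notin FV(\Gamma)$ then $\Gamma\vdash M:\forall\alpha.A$; if $\Gamma\vdash M:A$ and $A\le B$ then $\Gamma\vdash M:B$; $\Gamma\vdash 0:\mathsf{nat}$; $\Gamma\vdash S:\mathsf{nat}\to\mathsf{nat}$; $\Gamma\vdash\mathtt{rec}:\forall\alpha.\,(\alpha\uplus\Delta)\to(\mathsf{nat}^\Delta\to\alpha\uplus\Delta\to\alpha\uplus\Delta)\to(\mathsf{nat}^\Delta)\uplus\Delta'\to\alpha\uplus(\Delta\cup\Delta')$ for all finite $\Delta,\Delta'$; $\Gamma\vdash\mathtt{nil}:\forall\alpha.\mathsf{list}\,\alpha$; $\Gamma\vdash\mathtt{cons}:\forall\alpha.\,\alpha\to\mathsf{list}\,\alpha\to\mathsf{list}\,\alpha$; $\Gamma\vdash\mathtt{fold}:\forall\alpha.\forall\beta.\,(\alpha\uplus\Delta)\to(\beta^\Delta\to(\mathsf{list}\,\beta)^\Delta\to\alpha\uplus\Delta\to\alpha\uplus\Delta)\to((\mathsf{list}\,\beta)^\Delta)\uplus\Delta'\to\alpha\uplus(\Delta\cup\Delta')$ for all finite $\Delta,\Delta'$; $\Gamma\vdash\mathtt{raise}\,\varepsilon:\forall\alpha.(\alpha\uplus\{\varepsilon\})$; if $\Gamma\vdash M:A\uplus\{\varepsilon\}$ and $\Gamma\vdash N:A$ then $\Gamma\vdash\mathtt{try}\ M\ \mathtt{with}\ \varepsilon\mapsto N:A$. *)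

theory Defs
  imports Main "HOL-Library.FSet" "HOL-Library.Countable"
begin

text \<open>
  Terms and types modulo alpha-equivalence are represented with de Bruijn indices. The type
  parameter \<open>'e\<close>, of sort \<open>countable\<close> in the theorem, is the set of exception names.
\<close>

datatype 'e trm =
    Var nat
  | Lam "'e trm"
  | App "'e trm" "'e trm"  (infixl \<open>\<^bold>\<cdot>\<close> 200)
  | Raise 'e
  | Try "'e trm" 'e "'e trm"  \<comment> \<open>\<open>Try M \<epsilon> N\<close> is \<open>try M with \<epsilon> \<mapsto> N\<close>; no index is bound\<close>
  | Zero
  | Succ
  | Rec
  | LNil
  | LCons
  | LFold

primrec fv :: "'e trm \<Rightarrow> nat set" where
  "fv (Var i) = {i}"
| "fv (Lam M) = {i. Suc i \<in> fv M}"
| "fv (M \<^bold>\<cdot> N) = fv M \<union> fv N"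
| "fv (Raise \<epsilon>) = {}"
| "fv (Try M \<epsilon> N) = fv M \<union> fv N"
| "fv Zero = {}"
| "fv Succ = {}"
| "fv Rec = {}"
| "fv LNil = {}"
| "fv LCons = {}"
| "fv LFold = {}"

definition closed_trm :: "'e trm \<Rightarrow> bool" where
  "closed_trm M \<longleftrightarrow> fv M = {}"

text \<open>\<open>lift M k\<close> increments the free indices of \<open>M\<close> that are at least \<open>k\<close>.\<close>

primrec lift :: "'e trm \<Rightarrow> nat \<Rightarrow> 'e trm" where
  "lift (Var i) k = (if i < k then Var i else Var (Suc i))"
| "lift (Lam M) k = Lam (lift M (Suc k))"
| "lift (M \<^bold>\<cdot> N) k = lift M k \<^bold>\<cdot> lift N k"
| "lift (Raise \<epsilon>) k = Raise \<epsilon>"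
| "lift (Try M \<epsilon> N) k = Try (lift M k) \<epsilon> (lift N k)"
| "lift Zero k = Zero"
| "lift Succ k = Succ"
| "lift Rec k = Rec"
| "lift LNil k = LNil"
| "lift LCons k = LCons"
| "lift LFold k = LFold"

text \<open>
  \<open>subst M P k\<close> replaces index \<open>k\<close> by \<open>P\<close> and decrements the free indices above \<open>k\<close>, whose
  binder is removed; thus \<open>M[x:=N]\<close> for the body of \<open>\<lambda>x. M\<close> is \<open>subst M N 0\<close>.
\<close>

primrec subst :: "'e trm \<Rightarrow> 'e trm \<Rightarrow> nat \<Rightarrow> 'e trm" where
  "subst (Var i) P k = (if k < i then Var (i - 1) else if i = k then P else Var i)"
| "subst (Lam M) P k = Lam (subst M (lift P 0) (Suc k))"
| "subst (M \<^bold>\<cdot> N) P k = subst M P k \<^bold>\<cdot> subst N P k"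
| "subst (Raise \<epsilon>) P k = Raise \<epsilon>"
| "subst (Try M \<epsilon> N) P k = Try (subst M P k) \<epsilon> (subst N P k)"
| "subst Zero P k = Zero"
| "subst Succ P k = Succ"
| "subst Rec P k = Rec"
| "subst LNil P k = LNil"
| "subst LCons P k = LCons"
| "subst LFold P k = LFold"

inductive value_form :: "'e trm \<Rightarrow> bool" where
  "value_form (Lam M)"
| "value_form Zero"
| "value_form Succ"
| "value_form (Succ \<^bold>\<cdot> N)"
| "value_form Rec"
| "value_form (Rec \<^bold>\<cdot> M)"
| "value_form (Rec \<^bold>\<cdot> M \<^bold>\<cdot> N)"
| "value_form LNil"
| "value_form LCons"
| "value_form (LCons \<^bold>\<cdot> M)"
| "value_form (LCons \<^bold>\<cdot> M \<^bold>\<cdot> N)"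
| "value_form LFold"
| "value_form (LFold \<^bold>\<cdot> M)"
| "value_form (LFold \<^bold>\<cdot> M \<^bold>\<cdot> N)"

definition regular_value :: "'e trm \<Rightarrow> bool" where
  "regular_value V \<longleftrightarrow> closed_trm V \<and> value_form V"

inductive red :: "'e trm \<Rightarrow> 'e trm \<Rightarrow> bool"  (infix \<open>\<longmapsto>\<close> 50) where
  beta: "Lam M \<^bold>\<cdot> N \<longmapsto> subst M N 0"
| raise_app: "Raise \<epsilon> \<^bold>\<cdot> M \<longmapsto> Raise \<epsilon>"
| try_raise: "Try (Raise \<epsilon>) \<epsilon> N \<longmapsto> N"
| try_raise_other: "\<epsilon> \<noteq> \<epsilon>' \<Longrightarrow> Try (Raise \<epsilon>') \<epsilon> N \<longmapsto> Raise \<epsilon>'"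
| try_value: "regular_value V \<Longrightarrow> Try V \<epsilon> N \<longmapsto> V"
| rec_zero: "Rec \<^bold>\<cdot> X \<^bold>\<cdot> Y \<^bold>\<cdot> Zero \<longmapsto> X"
| rec_succ: "Rec \<^bold>\<cdot> X \<^bold>\<cdot> Y \<^bold>\<cdot> (Succ \<^bold>\<cdot> N) \<longmapsto> Y \<^bold>\<cdot> N \<^bold>\<cdot> (Rec \<^bold>\<cdot> X \<^bold>\<cdot> Y \<^bold>\<cdot> N)"
| rec_raise: "Rec \<^bold>\<cdot> X \<^bold>\<cdot> Y \<^bold>\<cdot> Raise \<epsilon> \<longmapsto> Raise \<epsilon>"
| fold_nil: "LFold \<^bold>\<cdot> X \<^bold>\<cdot> Y \<^bold>\<cdot> LNil \<longmapsto> X"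
| fold_cons: "LFold \<^bold>\<cdot> X \<^bold>\<cdot> Y \<^bold>\<cdot> (LCons \<^bold>\<cdot> E \<^bold>\<cdot> L) \<longmapsto> Y \<^bold>\<cdot> E \<^bold>\<cdot> L \<^bold>\<cdot> (LFold \<^bold>\<cdot> X \<^bold>\<cdot> Y \<^bold>\<cdot> L)"
| fold_raise: "LFold \<^bold>\<cdot> X \<^bold>\<cdot> Y \<^bold>\<cdot> Raise \<epsilon> \<longmapsto> Raise \<epsilon>"
| lam: "M \<longmapsto> M' \<Longrightarrow> Lam M \<longmapsto> Lam M'"
| app_left: "M \<longmapsto> M' \<Longrightarrow> M \<^bold>\<cdot> N \<longmapsto> M' \<^bold>\<cdot> N"
| app_right: "N \<longmapsto> N' \<Longrightarrow> M \<^bold>\<cdot> N \<longmapsto> M \<^bold>\<cdot> N'"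
| try_body: "M \<longmapsto> M' \<Longrightarrow> Try M \<epsilon> N \<longmapsto> Try M' \<epsilon> N"
| try_handler: "N \<longmapsto> N' \<Longrightarrow> Try M \<epsilon> N \<longmapsto> Try M \<epsilon> N'"

abbreviation reds :: "'e trm \<Rightarrow> 'e trm \<Rightarrow> bool"  (infix \<open>\<longmapsto>\<^sup>*\<close> 50) where
  "M \<longmapsto>\<^sup>* N \<equiv> red\<^sup>*\<^sup>* M N"

definition nat_trm :: "nat \<Rightarrow> 'e trm" where
  "nat_trm n = ((\<lambda>M. Succ \<^bold>\<cdot> M) ^^ n) Zero"

datatype 'e ty =
    TVar nat
  | TNat
  | TList "'e ty"
  | TArr "'e ty" "'e ty"  (infixr \<open>\<^bold>\<rightarrow>\<close> 110)
  | TAll "'e ty"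
  | TUnion "'e ty" "'e fset"  (infixl \<open>\<uplus>\<close> 120)
  | TCorr "'e ty" "'e fset"  (infixl \<open>\<up>\<close> 120)  \<comment> \<open>corruption, \<open>A\<close> with superscript \<open>\<Delta>\<close>\<close>

primrec tlift :: "'e ty \<Rightarrow> nat \<Rightarrow> 'e ty" where
  "tlift (TVar i) k = (if i < k then TVar i else TVar (Suc i))"
| "tlift TNat k = TNat"
| "tlift (TList A) k = TList (tlift A k)"
| "tlift (A \<^bold>\<rightarrow> B) k = tlift A k \<^bold>\<rightarrow> tlift B k"
| "tlift (TAll A) k = TAll (tlift A (Suc k))"
| "tlift (A \<uplus> \<Delta>) k = tlift A k \<uplus> \<Delta>"
| "tlift (A \<up> \<Delta>) k = tlift A k \<up> \<Delta>"

primrec tsubst :: "'e ty \<Rightarrow> 'e ty \<Rightarrow> nat \<Rightarrow> 'e ty" where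
  "tsubst (TVar i) C k = (if k < i then TVar (i - 1) else if i = k then C else TVar i)"
| "tsubst TNat C k = TNat"
| "tsubst (TList A) C k = TList (tsubst A C k)"
| "tsubst (A \<^bold>\<rightarrow> B) C k = tsubst A C k \<^bold>\<rightarrow> tsubst B C k"
| "tsubst (TAll A) C k = TAll (tsubst A (tlift C 0) (Suc k))"
| "tsubst (A \<uplus> \<Delta>) C k = tsubst A C k \<uplus> \<Delta>"
| "tsubst (A \<up> \<Delta>) C k = tsubst A C k \<up> \<Delta>"

text \<open>
  A side condition \<open>\<alpha> \<notin> FV(A)\<close> is expressed by writing \<open>tlift A 0\<close> where \<open>A\<close> occurs in the
  scope of \<open>\<alpha>\<close>, which is index \<open>0\<close> there.
\<close>

inductive subtype :: "'e ty \<Rightarrow> 'e ty \<Rightarrow> bool"  (infix \<open>\<preceq>\<close> 50) where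
  refl: "A \<preceq> A"
| trans: "A \<preceq> B \<Longrightarrow> B \<preceq> C \<Longrightarrow> A \<preceq> C"
| arr: "A' \<preceq> A \<Longrightarrow> B \<preceq> B' \<Longrightarrow> A \<^bold>\<rightarrow> B \<preceq> A' \<^bold>\<rightarrow> B'"
| all_right: "tlift A 0 \<preceq> B \<Longrightarrow> A \<preceq> TAll B"
| all_inst: "TAll A \<preceq> tsubst A B 0"
| all_arr: "TAll (tlift A 0 \<^bold>\<rightarrow> B) \<preceq> A \<^bold>\<rightarrow> TAll B"
| union_intro: "A \<preceq> A \<uplus> \<Delta>"
| union_corr: "A \<uplus> \<Delta> \<preceq> A \<up> \<Delta>"
| corr_empty: "A \<up> {||} \<preceq> A"
| union_mono: "A \<preceq> B \<Longrightarrow> A \<uplus> \<Delta> \<preceq> B \<uplus> \<Delta>"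
| arr_union: "(A \<^bold>\<rightarrow> B) \<uplus> \<Delta> \<preceq> A \<^bold>\<rightarrow> (B \<uplus> \<Delta>)"
| all_corr: "TAll (A \<up> \<Delta>) \<preceq> (TAll A) \<up> \<Delta>"
| all_union: "TAll (A \<uplus> \<Delta>) \<preceq> (TAll A) \<uplus> \<Delta>"
| list_corr: "TList (A \<up> \<Delta>) \<preceq> (TList A) \<up> \<Delta>"
| list_mono: "A \<preceq> B \<Longrightarrow> TList A \<preceq> TList B"
| union_union_left: "(A \<uplus> \<Delta>) \<uplus> \<Delta>' \<preceq> A \<uplus> (\<Delta> |\<union>| \<Delta>')"
| union_union_right: "A \<uplus> (\<Delta> |\<union>| \<Delta>') \<preceq> (A \<uplus> \<Delta>) \<uplus> \<Delta>'"
| corr_corr_left: "(A \<up> \<Delta>) \<up> \<Delta>' \<preceq> A \<up> (\<Delta> |\<union>| \<Delta>')"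
| corr_corr_right: "A \<up> (\<Delta> |\<union>| \<Delta>') \<preceq> (A \<up> \<Delta>) \<up> \<Delta>'"
| union_corr_left: "(A \<uplus> \<Delta>) \<up> \<Delta>' \<preceq> (A \<up> \<Delta>') \<uplus> \<Delta>"
| union_corr_right: "(A \<up> \<Delta>') \<uplus> \<Delta> \<preceq> (A \<uplus> \<Delta>) \<up> \<Delta>'"
| arr_corr_left: "(A \<^bold>\<rightarrow> B) \<up> \<Delta> \<preceq> A \<up> \<Delta> \<^bold>\<rightarrow> B \<up> \<Delta>"
| arr_corr_right: "A \<up> \<Delta> \<^bold>\<rightarrow> B \<up> \<Delta> \<preceq> (A \<^bold>\<rightarrow> B) \<up> \<Delta>"

text \<open>
  A context is a list of types, whose \<open>i\<close>-th entry is the type of the term variable \<open>i\<close>. In the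
  type of \<open>LFold\<close>, the variables bound by \<open>\<forall>\<alpha>. \<forall>\<beta>.\<close> are the indices \<open>1\<close> and \<open>0\<close>, respectively.
\<close>

inductive typing :: "'e ty list \<Rightarrow> 'e trm \<Rightarrow> 'e ty \<Rightarrow> bool"  (\<open>_ \<turnstile> _ : _\<close> [50, 50, 50] 50) where
  var: "i < length \<Gamma> \<Longrightarrow> \<Gamma> ! i = A \<Longrightarrow> \<Gamma> \<turnstile> Var i : A"
| lam: "A # \<Gamma> \<turnstile> M : B \<Longrightarrow> \<Gamma> \<turnstile> Lam M : A \<^bold>\<rightarrow> B"
| app: "\<Gamma> \<turnstile> M : A \<^bold>\<rightarrow> B \<Longrightarrow> \<Gamma> \<turnstile> N : A \<Longrightarrow> \<Gamma> \<turnstile> M \<^bold>\<cdot> N : B"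
| gen: "map (\<lambda>B. tlift B 0) \<Gamma> \<turnstile> M : A \<Longrightarrow> \<Gamma> \<turnstile> M : TAll A"
| sub: "\<Gamma> \<turnstile> M : A \<Longrightarrow> A \<preceq> B \<Longrightarrow> \<Gamma> \<turnstile> M : B"
| zero: "\<Gamma> \<turnstile> Zero : TNat"
| succ: "\<Gamma> \<turnstile> Succ : TNat \<^bold>\<rightarrow> TNat"
| recursor: "\<Gamma> \<turnstile> Rec : TAll
    (TVar 0 \<uplus> \<Delta>
     \<^bold>\<rightarrow> (TNat \<up> \<Delta> \<^bold>\<rightarrow> TVar 0 \<uplus> \<Delta> \<^bold>\<rightarrow> TVar 0 \<uplus> \<Delta>)
     \<^bold>\<rightarrow> (TNat \<up> \<Delta>) \<uplus> \<Delta>'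
     \<^bold>\<rightarrow> TVar 0 \<uplus> (\<Delta> |\<union>| \<Delta>'))"
| nil: "\<Gamma> \<turnstile> LNil : TAll (TList (TVar 0))"
| cons: "\<Gamma> \<turnstile> LCons : TAll (TVar 0 \<^bold>\<rightarrow> TList (TVar 0) \<^bold>\<rightarrow> TList (TVar 0))"
| fold: "\<Gamma> \<turnstile> LFold : TAll (TAll
    (TVar 1 \<uplus> \<Delta>
     \<^bold>\<rightarrow> (TVar 0 \<up> \<Delta> \<^bold>\<rightarrow> (TList (TVar 0)) \<up> \<Delta> \<^bold>\<rightarrow> TVar 1 \<uplus> \<Delta> \<^bold>\<rightarrow> TVar 1 \<uplus> \<Delta>)
     \<^bold>\<rightarrow> ((TList (TVar 0)) \<up> \<Delta>) \<uplus> \<Delta>'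
     \<^bold>\<rightarrow> TVar 1 \<uplus> (\<Delta> |\<union>| \<Delta>')))"
| raise: "\<Gamma> \<turnstile> Raise \<epsilon> : TAll (TVar 0 \<uplus> {|\<epsilon>|})"
| try_with: "\<Gamma> \<turnstile> M : A \<uplus> {|\<epsilon>|} \<Longrightarrow> \<Gamma> \<turnstile> N : A \<Longrightarrow> \<Gamma> \<turnstile> Try M \<epsilon> N : A"

end

theory Submission
  imports Defs
begin

text \<open>
  The proof is a realizability argument. A type is interpreted by a family of sets of closed terms
  indexed by a finite set \<open>D\<close> of exceptions, the value at \<open>D\<close> being the meaning of the type
  corrupted by \<open>D\<close>. The law \<open>A \<preceq> A \<up> \<Delta>\<close> forces these families to be monotone in \<open>D\<close> although
  arrows are contravariant; this is obtained, as in Kripke models, by letting the arrow at \<open>D\<close>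
  quantify over all \<open>D' \<supseteq> D\<close>. All sets are closed under weak head reduction and expansion, and
  their elements evaluate to a value or to an exception, so that \<open>try\<close> always makes progress. A
  realizer of \<open>TNat\<close> at the empty set evaluates hereditarily to a numeral.
\<close>

section \<open>Closed terms and substitution\<close>

text \<open>Closedness is lost on entering a binder, so the inductions below work with the bound
  \<open>fv M \<subseteq> {..<k}\<close>; this equivalence carries it through
  \<open>Lam\<close>.\<close>

lemma fv_Lam_bound: "fv (Lam M) \<subseteq> {..<n} \<longleftrightarrow> fv M \<subseteq> {..<Suc n}"
proof
  assume *: "fv (Lam M) \<subseteq> {..<n}"
  show "fv M \<subseteq> {..<Suc n}"
  proof
    fix i assume "i \<in> fv M"
    then show "i \<in> {..<Suc n}" using * by (cases i) auto
  qed
qed auto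

lemma lift_fresh: "fv M \<subseteq> {..<k} \<Longrightarrow> lift M k = M"
proof (induction M arbitrary: k)
  case (Lam M)
  then show ?case unfolding fv_Lam_bound by simp
qed auto

lemma subst_fresh: "fv M \<subseteq> {..<k} \<Longrightarrow> subst M P k = M"
proof (induction M arbitrary: k P)
  case (Lam M)
  then show ?case unfolding fv_Lam_bound by simp
qed auto

lemma closed_lift: "closed_trm M \<Longrightarrow> lift M k = M"
  by (rule lift_fresh) (simp add: closed_trm_def)

lemma closed_subst: "closed_trm M \<Longrightarrow> subst M P k = M"
  by (rule subst_fresh) (simp add: closed_trm_def)

lemma fv_subst_closed:
  "fv M \<subseteq> {..<Suc k} \<Longrightarrow> closed_trm P \<Longrightarrow> fv (subst M P k) \<subseteq> {..<k}"
proof (induction M arbitrary: k)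
  case (Lam M)
  then have "fv (subst M P (Suc k)) \<subseteq> {..<Suc k}"
    using fv_Lam_bound by blast
  with Lam.prems show ?case
    by (auto simp: closed_lift)
qed (auto simp: closed_trm_def)

lemma closed_App [simp]: "closed_trm (M \<^bold>\<cdot> N) \<longleftrightarrow> closed_trm M \<and> closed_trm N"
  by (auto simp: closed_trm_def)

lemma closed_Try [simp]: "closed_trm (Try M \<epsilon> N) \<longleftrightarrow> closed_trm M \<and> closed_trm N"
  by (auto simp: closed_trm_def)

lemma closed_const [simp]:
  "closed_trm (Raise \<epsilon>)" "closed_trm Zero" "closed_trm Succ" "closed_trm Rec"
  "closed_trm LNil" "closed_trm LCons" "closed_trm LFold"
  by (auto simp: closed_trm_def)

lemma closed_Lam: "closed_trm (Lam M) \<longleftrightarrow> fv M \<subseteq> {..<Suc 0}"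
  using fv_Lam_bound[of M 0] by (auto simp: closed_trm_def)

lemma closed_beta: "closed_trm (Lam M) \<Longrightarrow> closed_trm N \<Longrightarrow> closed_trm (subst M N 0)"
  using fv_subst_closed[of M 0 N] by (simp add: closed_Lam) (simp add: closed_trm_def)

text \<open>Only closed terms are meant to be in the range of \<open>\<sigma>\<close>, so no lifting is needed.\<close>

primrec psubst :: "(nat \<Rightarrow> 'e trm) \<Rightarrow> nat \<Rightarrow> 'e trm \<Rightarrow> 'e trm" where
  "psubst \<sigma> k (Var i) = (if i < k then Var i else \<sigma> (i - k))"
| "psubst \<sigma> k (Lam M) = Lam (psubst \<sigma> (Suc k) M)"
| "psubst \<sigma> k (M \<^bold>\<cdot> N) = psubst \<sigma> k M \<^bold>\<cdot> psubst \<sigma> k N"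
| "psubst \<sigma> k (Raise \<epsilon>) = Raise \<epsilon>"
| "psubst \<sigma> k (Try M \<epsilon> N) = Try (psubst \<sigma> k M) \<epsilon> (psubst \<sigma> k N)"
| "psubst \<sigma> k Zero = Zero"
| "psubst \<sigma> k Succ = Succ"
| "psubst \<sigma> k Rec = Rec"
| "psubst \<sigma> k LNil = LNil"
| "psubst \<sigma> k LCons = LCons"
| "psubst \<sigma> k LFold = LFold"

lemma fv_psubst: "(\<And>i. closed_trm (\<sigma> i)) \<Longrightarrow> fv (psubst \<sigma> k M) \<subseteq> {..<k}"
proof (induction M arbitrary: k)
  case (Lam M)
  then show ?case unfolding psubst.simps fv_Lam_bound by blast
qed (auto simp: closed_trm_def)

lemma closed_psubst: "(\<And>i. closed_trm (\<sigma> i)) \<Longrightarrow> closed_trm (psubst \<sigma> 0 M)"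
  using fv_psubst[of \<sigma> 0 M] by (simp add: closed_trm_def)

lemma psubst_fresh: "fv M \<subseteq> {..<k} \<Longrightarrow> psubst \<sigma> k M = M"
proof (induction M arbitrary: k)
  case (Lam M)
  then show ?case unfolding fv_Lam_bound by simp
qed auto

text \<open>Serves the case of abstraction in soundness: contracting an instantiated
  \<open>Lam\<close> amounts to instantiating its body in an environment extended by the
  argument.\<close>

lemma subst_psubst:
  assumes "\<And>i. closed_trm (\<sigma> i)" and "closed_trm N"
  shows "subst (psubst \<sigma> (Suc k) M) N k = psubst (case_nat N \<sigma>) k M"
proof (induction M arbitrary: k)
  case (Var i)
  show ?case
  proof (cases "i < Suc k")
    case True
    then show ?thesis by (cases "i = k") auto
  next
    case False
    then obtain j where "i = Suc (k + j)" using less_imp_Suc_add[of k i] by auto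
    \<comment> \<open>Both sides are \<open>\<sigma> j\<close>: the substitution for
      \<open>k\<close> leaves this closed term alone, and \<open>case_nat\<close> skips its new
      entry.\<close>
    then show ?thesis using assms(1) by (simp add: closed_subst Suc_diff_le)
  qed
qed (auto simp: closed_lift assms(2))

lemma typing_fv: "\<Gamma> \<turnstile> M : A \<Longrightarrow> fv M \<subseteq> {..<length \<Gamma>}"
proof (induction rule: typing.induct)
  case (lam A \<Gamma> M B)
  then show ?case unfolding fv_Lam_bound by simp
qed auto

section \<open>Weak head reduction\<close>

text \<open>A deterministic strategy within the given reduction. It evaluates only what a
  contraction must inspect: the head of an application, the body of \<open>Try\<close>, and the
  third argument of \<open>Rec\<close> and \<open>LFold\<close>. Arguments of \<open>Succ\<close>
  and \<open>LCons\<close> stay unevaluated.\<close>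

inductive whr :: "'e trm \<Rightarrow> 'e trm \<Rightarrow> bool"  (infix \<open>\<rightarrow>\<^sub>w\<close> 50) where
  beta: "Lam M \<^bold>\<cdot> N \<rightarrow>\<^sub>w subst M N 0"
| raise_app: "Raise \<epsilon> \<^bold>\<cdot> M \<rightarrow>\<^sub>w Raise \<epsilon>"
| try_raise: "Try (Raise \<epsilon>) \<epsilon> N \<rightarrow>\<^sub>w N"
| try_raise_other: "\<epsilon> \<noteq> \<epsilon>' \<Longrightarrow> Try (Raise \<epsilon>') \<epsilon> N \<rightarrow>\<^sub>w Raise \<epsilon>'"
| try_value: "regular_value V \<Longrightarrow> Try V \<epsilon> N \<rightarrow>\<^sub>w V"
| rec_zero: "Rec \<^bold>\<cdot> X \<^bold>\<cdot> Y \<^bold>\<cdot> Zero \<rightarrow>\<^sub>w X"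
| rec_succ: "Rec \<^bold>\<cdot> X \<^bold>\<cdot> Y \<^bold>\<cdot> (Succ \<^bold>\<cdot> N) \<rightarrow>\<^sub>w Y \<^bold>\<cdot> N \<^bold>\<cdot> (Rec \<^bold>\<cdot> X \<^bold>\<cdot> Y \<^bold>\<cdot> N)"
| rec_raise: "Rec \<^bold>\<cdot> X \<^bold>\<cdot> Y \<^bold>\<cdot> Raise \<epsilon> \<rightarrow>\<^sub>w Raise \<epsilon>"
| fold_nil: "LFold \<^bold>\<cdot> X \<^bold>\<cdot> Y \<^bold>\<cdot> LNil \<rightarrow>\<^sub>w X"
| fold_cons: "LFold \<^bold>\<cdot> X \<^bold>\<cdot> Y \<^bold>\<cdot> (LCons \<^bold>\<cdot> E \<^bold>\<cdot> L) \<rightarrow>\<^sub>w Y \<^bold>\<cdot> E \<^bold>\<cdot> L \<^bold>\<cdot> (LFold \<^bold>\<cdot> X \<^bold>\<cdot> Y \<^bold>\<cdot> L)"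
| fold_raise: "LFold \<^bold>\<cdot> X \<^bold>\<cdot> Y \<^bold>\<cdot> Raise \<epsilon> \<rightarrow>\<^sub>w Raise \<epsilon>"
| app: "M \<rightarrow>\<^sub>w M' \<Longrightarrow> M \<^bold>\<cdot> N \<rightarrow>\<^sub>w M' \<^bold>\<cdot> N"
| try_body: "M \<rightarrow>\<^sub>w M' \<Longrightarrow> Try M \<epsilon> N \<rightarrow>\<^sub>w Try M' \<epsilon> N"
| rec_arg: "N \<rightarrow>\<^sub>w N' \<Longrightarrow> Rec \<^bold>\<cdot> X \<^bold>\<cdot> Y \<^bold>\<cdot> N \<rightarrow>\<^sub>w Rec \<^bold>\<cdot> X \<^bold>\<cdot> Y \<^bold>\<cdot> N'"
| fold_arg: "N \<rightarrow>\<^sub>w N' \<Longrightarrow> LFold \<^bold>\<cdot> X \<^bold>\<cdot> Y \<^bold>\<cdot> N \<rightarrow>\<^sub>w LFold \<^bold>\<cdot> X \<^bold>\<cdot> Y \<^bold>\<cdot> N'"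

abbreviation whrs :: "'e trm \<Rightarrow> 'e trm \<Rightarrow> bool"  (infix \<open>\<rightarrow>\<^sub>w\<^sup>*\<close> 50) where
  "M \<rightarrow>\<^sub>w\<^sup>* N \<equiv> whr\<^sup>*\<^sup>* M N"

inductive_cases whr_constE [elim!]:
  "Lam M \<rightarrow>\<^sub>w N" "Raise \<epsilon> \<rightarrow>\<^sub>w N" "Zero \<rightarrow>\<^sub>w N" "Succ \<rightarrow>\<^sub>w N" "Rec \<rightarrow>\<^sub>w N" "LNil \<rightarrow>\<^sub>w N"
  "LCons \<rightarrow>\<^sub>w N" "LFold \<rightarrow>\<^sub>w N"
  "Succ \<^bold>\<cdot> M \<rightarrow>\<^sub>w N" "Rec \<^bold>\<cdot> M \<rightarrow>\<^sub>w N" "Rec \<^bold>\<cdot> M \<^bold>\<cdot> M' \<rightarrow>\<^sub>w N"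
  "LCons \<^bold>\<cdot> M \<rightarrow>\<^sub>w N" "LCons \<^bold>\<cdot> M \<^bold>\<cdot> M' \<rightarrow>\<^sub>w N" "LFold \<^bold>\<cdot> M \<rightarrow>\<^sub>w N" "LFold \<^bold>\<cdot> M \<^bold>\<cdot> M' \<rightarrow>\<^sub>w N"

inductive_cases whr_AppE: "M \<^bold>\<cdot> N \<rightarrow>\<^sub>w P"
inductive_cases whr_TryE: "Try M \<epsilon> N \<rightarrow>\<^sub>w P"

definition answer :: "'e trm \<Rightarrow> bool" where
  "answer V \<longleftrightarrow> value_form V \<or> (\<exists>\<epsilon>. V = Raise \<epsilon>)"

lemma answer_simps [simp]:
  "answer (Lam M)" "answer (Raise \<epsilon>)" "answer Zero" "answer Succ" "answer (Succ \<^bold>\<cdot> M)"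
  "answer Rec" "answer (Rec \<^bold>\<cdot> M)" "answer (Rec \<^bold>\<cdot> M \<^bold>\<cdot> N)" "answer LNil" "answer LCons"
  "answer (LCons \<^bold>\<cdot> M)" "answer (LCons \<^bold>\<cdot> M \<^bold>\<cdot> N)" "answer LFold" "answer (LFold \<^bold>\<cdot> M)"
  "answer (LFold \<^bold>\<cdot> M \<^bold>\<cdot> N)"
  by (auto simp: answer_def intro: value_form.intros)

lemma value_no_step: "value_form V \<Longrightarrow> \<not> V \<rightarrow>\<^sub>w N"
  by (auto elim: value_form.cases)

lemma answer_no_step: "answer V \<Longrightarrow> \<not> V \<rightarrow>\<^sub>w N"
  by (auto simp: answer_def value_no_step)

lemma Raise_not_value: "\<not> value_form (Raise \<epsilon>)"
  by (auto elim: value_form.cases)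

text \<open>A congruence rule could compete with a contraction only if some answer could step, which
  none can. Among the contractions, \<open>try_value\<close> excludes the two rules for a raised
  exception because \<open>Raise\<close> is not a value form.\<close>

lemma whr_deterministic: "M \<rightarrow>\<^sub>w N \<Longrightarrow> M \<rightarrow>\<^sub>w P \<Longrightarrow> N = P"
proof (induction arbitrary: P rule: whr.induct)
  case (app M M' N)
  from app.prems app.hyps show ?case
    by - (erule whr_AppE; auto dest: app.IH)
next
  case (try_body M M' \<epsilon> N)
  from try_body.prems try_body.hyps show ?case
    by - (erule whr_TryE; auto dest: try_body.IH simp: regular_value_def value_no_step)
next
  case (rec_arg N N' X Y)
  from rec_arg.prems rec_arg.hyps show ?case
    by - (erule whr_AppE; auto dest: rec_arg.IH)
next
  case (fold_arg N N' X Y)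
  from fold_arg.prems fold_arg.hyps show ?case
    by - (erule whr_AppE; auto dest: fold_arg.IH)
qed ((erule whr_AppE whr_TryE; auto simp: regular_value_def value_no_step Raise_not_value)+)

lemma whr_closed: "M \<rightarrow>\<^sub>w N \<Longrightarrow> closed_trm M \<Longrightarrow> closed_trm N"
  by (induction rule: whr.induct) (auto simp: closed_beta)

lemma whr_red: "M \<rightarrow>\<^sub>w N \<Longrightarrow> M \<longmapsto> N"
  by (induction rule: whr.induct) (auto intro: red.intros)

lemma whrs_reds: "M \<rightarrow>\<^sub>w\<^sup>* N \<Longrightarrow> M \<longmapsto>\<^sup>* N"
  using mono_rtranclp[of whr red] whr_red by blast

lemma whrs_closed: "M \<rightarrow>\<^sub>w\<^sup>* N \<Longrightarrow> closed_trm M \<Longrightarrow> closed_trm N"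
  by (induction rule: rtranclp_induct) (auto intro: whr_closed)

lemma whrs_map:
  assumes "M \<rightarrow>\<^sub>w\<^sup>* N" and "\<And>M N. M \<rightarrow>\<^sub>w N \<Longrightarrow> f M \<rightarrow>\<^sub>w f N"
  shows "f M \<rightarrow>\<^sub>w\<^sup>* f N"
  using assms(1) by (induction rule: rtranclp_induct) (auto intro: rtranclp.rtrancl_into_rtrancl assms(2))

text \<open>By determinism the given step begins every path from \<open>M\<close> to
  \<open>V\<close>, and the path is not empty because \<open>V\<close> cannot step. Closure of the
  realizer sets under both reduction and expansion comes from here.\<close>

lemma whrs_answer_step:
  assumes "M \<rightarrow>\<^sub>w N" and "answer V"
  shows "M \<rightarrow>\<^sub>w\<^sup>* V \<longleftrightarrow> N \<rightarrow>\<^sub>w\<^sup>* V"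
proof
  assume "M \<rightarrow>\<^sub>w\<^sup>* V"
  then show "N \<rightarrow>\<^sub>w\<^sup>* V"
    using assms by (cases rule: converse_rtranclpE) (auto simp: answer_no_step dest: whr_deterministic)
qed (use assms(1) in auto)

section \<open>Candidates\<close>

definition normalizing :: "'e trm \<Rightarrow> bool" where
  "normalizing M \<longleftrightarrow> closed_trm M \<and> (\<exists>V. answer V \<and> M \<rightarrow>\<^sub>w\<^sup>* V)"

definition raising :: "'e fset \<Rightarrow> 'e trm set" where
  "raising D = {M. closed_trm M \<and> (\<exists>\<epsilon>. \<epsilon> |\<in>| D \<and> M \<rightarrow>\<^sub>w\<^sup>* Raise \<epsilon>)}"

definition saturated :: "'e trm set \<Rightarrow> bool" where
  "saturated S \<longleftrightarrow> S \<subseteq> Collect normalizing \<and>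
     (\<forall>M N. closed_trm M \<longrightarrow> M \<rightarrow>\<^sub>w N \<longrightarrow> (M \<in> S \<longleftrightarrow> N \<in> S))"

text \<open>The condition on \<open>raising D\<close> makes
  \<open>A \<uplus> \<Delta> \<preceq> A \<up> \<Delta>\<close> sound: at the enlarged index the
  added exceptions already belong to the set.\<close>

definition candidate :: "('e fset \<Rightarrow> 'e trm set) \<Rightarrow> bool" where
  "candidate X \<longleftrightarrow> mono X \<and> (\<forall>D. saturated (X D) \<and> raising D \<subseteq> X D)"

lemma saturatedI:
  assumes "\<And>M. M \<in> S \<Longrightarrow> normalizing M"
    and "\<And>M N. closed_trm M \<Longrightarrow> closed_trm N \<Longrightarrow> M \<rightarrow>\<^sub>w N \<Longrightarrow> M \<in> S \<longleftrightarrow> N \<in> S"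
  shows "saturated S"
  using assms whr_closed unfolding saturated_def by blast

lemma saturated_normalizing: "saturated S \<Longrightarrow> M \<in> S \<Longrightarrow> normalizing M"
  by (auto simp: saturated_def)

lemma saturated_step: "saturated S \<Longrightarrow> closed_trm M \<Longrightarrow> M \<rightarrow>\<^sub>w N \<Longrightarrow> M \<in> S \<longleftrightarrow> N \<in> S"
  by (auto simp: saturated_def)

lemma saturated_steps:
  assumes "M \<rightarrow>\<^sub>w\<^sup>* N" and "saturated S" and "closed_trm M"
  shows "M \<in> S \<longleftrightarrow> N \<in> S"
  using assms by (induction rule: converse_rtranclp_induct) (auto simp: saturated_step whr_closed)

lemma normalizing_closed: "normalizing M \<Longrightarrow> closed_trm M"
  by (simp add: normalizing_def)

lemma normalizing_answer: "closed_trm V \<Longrightarrow> answer V \<Longrightarrow> normalizing V"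
  by (auto simp: normalizing_def)

lemma normalizing_step:
  "closed_trm M \<Longrightarrow> M \<rightarrow>\<^sub>w N \<Longrightarrow> normalizing M \<longleftrightarrow> normalizing N"
  by (auto simp: normalizing_def whr_closed whrs_answer_step)

lemma raising_mono: "D |\<subseteq>| D' \<Longrightarrow> raising D \<subseteq> raising D'"
  by (auto simp: raising_def)

lemma raising_union: "raising (D |\<union>| D') = raising D \<union> raising D'"
  by (auto simp: raising_def)

lemma saturated_raising: "saturated (raising D)"
  by (rule saturatedI) (auto simp: raising_def normalizing_def whrs_answer_step intro: answer_simps)

lemma saturated_Un: "saturated S \<Longrightarrow> saturated T \<Longrightarrow> saturated (S \<union> T)"
  by (auto simp: saturated_def)

lemma candidateD:
  assumes "candidate X"
  shows candidate_mono: "D |\<subseteq>| D' \<Longrightarrow> X D \<subseteq> X D'"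
    and candidate_saturated: "saturated (X D)"
    and candidate_raising: "raising D \<subseteq> X D"
  using assms by (auto simp: candidate_def dest: monoD)

section \<open>Realizers of natural numbers and lists\<close>

text \<open>Since \<open>Succ\<close> is lazy, an exception from \<open>D\<close> may hide below any
  number of successors. This makes \<open>nats D\<close> the corruption of \<open>nat\<close> by
  \<open>D\<close>, which is larger than a mere union with exceptions at the top.\<close>

inductive_set nats :: "'e fset \<Rightarrow> 'e trm set" for D where
  zero: "closed_trm M \<Longrightarrow> M \<rightarrow>\<^sub>w\<^sup>* Zero \<Longrightarrow> M \<in> nats D"
| succ: "closed_trm M \<Longrightarrow> M \<rightarrow>\<^sub>w\<^sup>* Succ \<^bold>\<cdot> N \<Longrightarrow> N \<in> nats D \<Longrightarrow> M \<in> nats D"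
| raise: "M \<in> raising D \<Longrightarrow> M \<in> nats D"

text \<open>The element set \<open>S\<close> and the exceptions \<open>D\<close> of the spine are
  independent parameters, so that the induction does not involve the family of element sets. Both
  follow the same index in \<open>\<lambda>D. lists_of (X D) D\<close>.\<close>

inductive_set lists_of :: "'e trm set \<Rightarrow> 'e fset \<Rightarrow> 'e trm set" for S D where
  nil: "closed_trm M \<Longrightarrow> M \<rightarrow>\<^sub>w\<^sup>* LNil \<Longrightarrow> M \<in> lists_of S D"
| cons: "closed_trm M \<Longrightarrow> M \<rightarrow>\<^sub>w\<^sup>* LCons \<^bold>\<cdot> E \<^bold>\<cdot> L \<Longrightarrow> E \<in> S \<Longrightarrow> L \<in> lists_of S D \<Longrightarrow> M \<in> lists_of S D"
| raise: "M \<in> raising D \<Longrightarrow> M \<in> lists_of S D"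

lemma saturated_nats: "saturated (nats D)"
proof (rule saturatedI)
  fix M :: "'a trm" assume "M \<in> nats D"
  then show "normalizing M"
    by cases (auto simp: normalizing_def raising_def intro: answer_simps)
next
  fix M N :: "'a trm"
  assume *: "closed_trm M" "closed_trm N" "M \<rightarrow>\<^sub>w N"
  have "M \<in> raising D \<longleftrightarrow> N \<in> raising D"
    using * saturated_step[OF saturated_raising] by blast
  with * show "M \<in> nats D \<longleftrightarrow> N \<in> nats D"
    \<comment> \<open>One unfolding on each side is enough: every clause depends on the term only
      through the answer it reaches, and \<open>M\<close> and \<open>N\<close> reach the same
      answers.\<close>
    by (subst (1 2) nats.simps) (simp add: whrs_answer_step)
qed

lemma saturated_lists_of: "saturated (lists_of S D)"
proof (rule saturatedI)
  fix M :: "'a trm" assume "M \<in> lists_of S D"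
  then show "normalizing M"
    by cases (auto simp: normalizing_def raising_def intro: answer_simps)
next
  fix M N :: "'a trm"
  assume *: "closed_trm M" "closed_trm N" "M \<rightarrow>\<^sub>w N"
  have "M \<in> raising D \<longleftrightarrow> N \<in> raising D"
    using * saturated_step[OF saturated_raising] by blast
  with * show "M \<in> lists_of S D \<longleftrightarrow> N \<in> lists_of S D"
    by (subst (1 2) lists_of.simps) (simp add: whrs_answer_step)
qed

lemma lists_of_mono:
  assumes "S \<subseteq> S'" and "D |\<subseteq>| D'"
  shows "lists_of S D \<subseteq> lists_of S' D'"
proof
  fix M assume "M \<in> lists_of S D"
  then show "M \<in> lists_of S' D'"
    by induction (use assms raising_mono[OF assms(2)] in \<open>auto intro: lists_of.intros\<close>)
qed

lemma nats_mono: "D |\<subseteq>| D' \<Longrightarrow> nats D \<subseteq> nats D'"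
proof
  fix M assume "D |\<subseteq>| D'" and "M \<in> nats D"
  from this(2) show "M \<in> nats D'"
    by induction (use raising_mono[OF \<open>D |\<subseteq>| D'\<close>] in \<open>auto intro: nats.intros\<close>)
qed

lemma candidate_nats: "candidate nats"
  unfolding candidate_def
proof (intro conjI allI)
  show "mono nats"
    by (intro monoI nats_mono)
qed (auto simp: saturated_nats intro: nats.raise)

section \<open>Closure of candidates under the type constructors\<close>

definition arrow ::
  "('e fset \<Rightarrow> 'e trm set) \<Rightarrow> ('e fset \<Rightarrow> 'e trm set) \<Rightarrow> 'e fset \<Rightarrow> 'e trm set" where
  "arrow X Y D = {M. normalizing M \<and> (\<forall>D' N. D |\<subseteq>| D' \<longrightarrow> N \<in> X D' \<longrightarrow> M \<^bold>\<cdot> N \<in> Y D')}"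

lemma arrowI:
  assumes "normalizing M" and "\<And>D' N. D |\<subseteq>| D' \<Longrightarrow> N \<in> X D' \<Longrightarrow> M \<^bold>\<cdot> N \<in> Y D'"
  shows "M \<in> arrow X Y D"
  using assms by (simp add: arrow_def)

lemma arrowD: "M \<in> arrow X Y D \<Longrightarrow> D |\<subseteq>| D' \<Longrightarrow> N \<in> X D' \<Longrightarrow> M \<^bold>\<cdot> N \<in> Y D'"
  by (simp add: arrow_def)

lemma arrow_mono:
  assumes "\<And>D. X' D \<subseteq> X D" and "\<And>D. Y D \<subseteq> Y' D"
  shows "arrow X Y D \<subseteq> arrow X' Y' D"
  using assms unfolding arrow_def by blast

lemma arrow_normalizing: "M \<in> arrow X Y D \<Longrightarrow> normalizing M"
  by (simp add: arrow_def)

lemma whrs_raise_app: "M \<rightarrow>\<^sub>w\<^sup>* Raise \<epsilon> \<Longrightarrow> M \<^bold>\<cdot> N \<rightarrow>\<^sub>w\<^sup>* Raise \<epsilon>"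
  using whrs_map[of M "Raise \<epsilon>" "\<lambda>M. M \<^bold>\<cdot> N"] whr.app whr.raise_app rtranclp.rtrancl_into_rtrancl
  by metis

lemma raising_app: "M \<in> raising D \<Longrightarrow> closed_trm N \<Longrightarrow> M \<^bold>\<cdot> N \<in> raising D"
  by (auto simp: raising_def dest: whrs_raise_app)

lemma candidate_closed: "candidate X \<Longrightarrow> M \<in> X D \<Longrightarrow> closed_trm M"
  using candidate_saturated saturated_normalizing normalizing_closed by blast

lemma candidate_arrow:
  assumes X: "candidate X" and Y: "candidate Y"
  shows "candidate (arrow X Y)"
  unfolding candidate_def
proof (intro conjI allI)
  show "mono (arrow X Y)"
    by (auto intro!: monoI simp: arrow_def)
next
  fix D
  show "saturated (arrow X Y D)"
  proof (rule saturatedI)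
    fix M N :: "'a trm"
    assume *: "closed_trm M" "closed_trm N" "M \<rightarrow>\<^sub>w N"
    have "M \<^bold>\<cdot> P \<in> Y D' \<longleftrightarrow> N \<^bold>\<cdot> P \<in> Y D'" if "P \<in> X D'" for P D'
      using saturated_step[OF candidate_saturated[OF Y], of "M \<^bold>\<cdot> P" "N \<^bold>\<cdot> P"] *
        candidate_closed[OF X that] by (auto intro: whr.app)
    with * show "M \<in> arrow X Y D \<longleftrightarrow> N \<in> arrow X Y D"
      by (auto simp: arrow_def normalizing_step)
  qed (rule arrow_normalizing)
next
  fix D
  show "raising D \<subseteq> arrow X Y D"
  proof
    fix M assume M: "M \<in> raising D"
    show "M \<in> arrow X Y D"
    proof (rule arrowI)
      show "normalizing M"
        using M saturated_normalizing[OF saturated_raising] by blast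
      fix D' N assume "D |\<subseteq>| D'" "N \<in> X D'"
      then show "M \<^bold>\<cdot> N \<in> Y D'"
        using raising_app[OF M] candidate_closed[OF X] raising_mono candidate_raising[OF Y] by blast
    qed
  qed
qed

lemma candidate_lists_of:
  assumes "candidate X"
  shows "candidate (\<lambda>D. lists_of (X D) D)"
  unfolding candidate_def
proof (intro conjI allI)
  show "mono (\<lambda>D. lists_of (X D) D)"
    by (intro monoI lists_of_mono candidate_mono[OF assms])
qed (auto simp: saturated_lists_of intro: lists_of.raise)

lemma candidate_Un_raising: "candidate X \<Longrightarrow> candidate (\<lambda>D. X D \<union> raising \<Delta>)"
  by (auto simp: candidate_def saturated_Un saturated_raising intro!: monoI dest: monoD)

lemma candidate_corrupt: "candidate X \<Longrightarrow> candidate (\<lambda>D. X (D |\<union>| \<Delta>))"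
  unfolding candidate_def
proof (intro conjI allI)
  assume X: "mono X \<and> (\<forall>D. saturated (X D) \<and> raising D \<subseteq> X D)"
  show "mono (\<lambda>D. X (D |\<union>| \<Delta>))"
  proof (rule monoI)
    fix D D' :: "'a fset" assume "D |\<subseteq>| D'"
    then have "D |\<union>| \<Delta> |\<subseteq>| D' |\<union>| \<Delta>" by auto
    then show "X (D |\<union>| \<Delta>) \<subseteq> X (D' |\<union>| \<Delta>)" by (rule monoD[OF conjunct1[OF X]])
  qed
  show "raising D \<subseteq> X (D |\<union>| \<Delta>)" for D
    using X raising_mono[of D "D |\<union>| \<Delta>"] by blast
qed auto

text \<open>The family must be nonempty because an empty intersection would contain terms that do
  not normalize.\<close>

lemma candidate_INT:
  assumes "\<X> \<noteq> {}" and "\<And>X. X \<in> \<X> \<Longrightarrow> candidate X"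
  shows "candidate (\<lambda>D. \<Inter>X\<in>\<X>. X D)"
  unfolding candidate_def
proof (intro conjI allI)
  show "mono (\<lambda>D. \<Inter>X\<in>\<X>. X D)"
    by (intro monoI INT_anti_mono subset_refl candidate_mono assms(2))
  show "saturated (\<Inter>X\<in>\<X>. X D)" for D
  proof (rule saturatedI)
    show "normalizing M" if "M \<in> (\<Inter>X\<in>\<X>. X D)" for M
      using that assms candidate_saturated saturated_normalizing by blast
    show "M \<in> (\<Inter>X\<in>\<X>. X D) \<longleftrightarrow> N \<in> (\<Inter>X\<in>\<X>. X D)" if "closed_trm M" "M \<rightarrow>\<^sub>w N" for M N
    proof -
      have "M \<in> X D \<longleftrightarrow> N \<in> X D" if "X \<in> \<X>" for X
        using saturated_step[OF candidate_saturated[OF assms(2)[OF that]]] \<open>closed_trm M\<close>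
          \<open>M \<rightarrow>\<^sub>w N\<close> by blast
      then show ?thesis by auto
    qed
  qed
  show "raising D \<subseteq> (\<Inter>X\<in>\<X>. X D)" for D
    using assms(2) candidate_raising by blast
qed

section \<open>Interpretation of types\<close>

text \<open>Insertion of a value at index \<open>k\<close> of an environment, the semantic
  counterpart of \<open>tlift\<close> and \<open>tsubst\<close> at \<open>k\<close>.\<close>

definition shift :: "nat \<Rightarrow> 'a \<Rightarrow> (nat \<Rightarrow> 'a) \<Rightarrow> nat \<Rightarrow> 'a" where
  "shift k X \<rho> i = (if i < k then \<rho> i else if i = k then X else \<rho> (i - 1))"

text \<open>Exchanges an insertion with the one made by a quantifier, as needed for
  \<open>TAll\<close> in the lemmas on lifting and substitution.\<close>

lemma shift_shift: "shift (Suc k) Y (shift 0 X \<rho>) = shift 0 X (shift k Y \<rho>)"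
  by (rule ext) (auto simp: shift_def)

text \<open>Quantification is impredicative, over all candidates. Union adds exceptions at the top
  only, whereas corruption enlarges the index and thereby reaches all components of the type. The
  intersection ranges over an image to match \<open>candidate_INT\<close>.\<close>

primrec interp :: "'e ty \<Rightarrow> (nat \<Rightarrow> 'e fset \<Rightarrow> 'e trm set) \<Rightarrow> 'e fset \<Rightarrow> 'e trm set" where
  "interp (TVar i) \<rho> = \<rho> i"
| "interp TNat \<rho> = nats"
| "interp (TList A) \<rho> = (\<lambda>D. lists_of (interp A \<rho> D) D)"
| "interp (A \<^bold>\<rightarrow> B) \<rho> = arrow (interp A \<rho>) (interp B \<rho>)"
| "interp (TAll A) \<rho> = (\<lambda>D. \<Inter>Y\<in>(\<lambda>X. interp A (shift 0 X \<rho>)) ` Collect candidate. Y D)"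
| "interp (A \<uplus> \<Delta>) \<rho> = (\<lambda>D. interp A \<rho> D \<union> raising \<Delta>)"
| "interp (A \<up> \<Delta>) \<rho> = (\<lambda>D. interp A \<rho> (D |\<union>| \<Delta>))"

lemma mem_interp_TAll:
  "M \<in> interp (TAll A) \<rho> D \<longleftrightarrow> (\<forall>X. candidate X \<longrightarrow> M \<in> interp A (shift 0 X \<rho>) D)"
  by auto

lemma candidate_shift: "(\<And>i. candidate (\<rho> i)) \<Longrightarrow> candidate X \<Longrightarrow> candidate (shift k X \<rho> i)"
  by (simp add: shift_def)

lemma candidate_interp: "(\<And>i. candidate (\<rho> i)) \<Longrightarrow> candidate (interp A \<rho>)"
proof (induction A arbitrary: \<rho>)
  case (TAll A)
  show ?case
    unfolding interp.simps
  proof (rule candidate_INT)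
    show "(\<lambda>X. interp A (shift 0 X \<rho>)) ` Collect candidate \<noteq> {}"
      using candidate_nats by blast
  qed (auto intro!: TAll candidate_shift)
qed (auto simp: candidate_nats candidate_arrow candidate_lists_of candidate_Un_raising
       candidate_corrupt)

lemma interp_tlift: "interp (tlift A k) (shift k X \<rho>) = interp A \<rho>"
proof (induction A arbitrary: k \<rho>)
  case (TAll A)
  show ?case by (simp add: TAll flip: shift_shift)
qed (auto simp: shift_def)

lemma interp_tsubst: "interp (tsubst A C k) \<rho> = interp A (shift k (interp C \<rho>) \<rho>)"
proof (induction A arbitrary: C k \<rho>)
  case (TAll A)
  show ?case by (simp add: TAll interp_tlift shift_shift)
qed (auto simp: shift_def)

theorem subtype_sound:
  assumes "A \<preceq> B" and "\<And>i. candidate (\<rho> i)"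
  shows "interp A \<rho> D \<subseteq> interp B \<rho> D"
  using assms
proof (induction arbitrary: \<rho> D rule: subtype.induct)
  case (trans A B C)
  show ?case by (rule order_trans[OF trans.IH(1) trans.IH(2)]) (rule trans.prems)+
next
  case (arr A' A B B')
  show ?case
    unfolding interp.simps by (rule arrow_mono) (rule arr.IH[OF arr.prems])+
next
  case (all_right A B)
  have "interp A \<rho> D \<subseteq> interp B (shift 0 X \<rho>) D" if "candidate X" for X
    using all_right.IH[of "shift 0 X \<rho>" D] candidate_shift[OF all_right.prems that]
    by (simp add: interp_tlift)
  then show ?case by auto
next
  case (all_inst A B)
  show ?case using candidate_interp[of \<rho>, OF all_inst] by (auto simp: interp_tsubst)
next
  case (all_arr A B)
  show ?case
  proof
    fix M assume "M \<in> interp (TAll (tlift A 0 \<^bold>\<rightarrow> B)) \<rho> D"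
    then have M: "M \<in> arrow (interp A \<rho>) (interp B (shift 0 X \<rho>)) D" if "candidate X" for X
      using that by (simp add: interp_tlift)
    show "M \<in> interp (A \<^bold>\<rightarrow> TAll B) \<rho> D"
      \<comment> \<open>Normalization does not mention the quantified candidate, so any instance
        yields it; \<open>nats\<close> is an arbitrary choice.\<close>
      using arrow_normalizing[OF M[OF candidate_nats]] arrowD[OF M] by (auto intro: arrowI)
  qed
next
  case (union_corr A \<Delta>)
  have "candidate (interp A \<rho>)" by (rule candidate_interp) (rule union_corr)
  from candidate_mono[OF this, of D "D |\<union>| \<Delta>"] candidate_raising[OF this, of "D |\<union>| \<Delta>"]
    raising_mono[of \<Delta> "D |\<union>| \<Delta>"]
  show ?case by auto
next
  case (union_mono A B \<Delta>)
  have "interp A \<rho> D \<subseteq> interp B \<rho> D"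
    by (rule union_mono.IH) (rule union_mono.prems)
  then show ?case by auto
next
  case (arr_union A B \<Delta>)
  have A: "candidate (interp A \<rho>)" by (rule candidate_interp) (rule arr_union)
  have "M \<in> arrow (interp A \<rho>) (\<lambda>D. interp B \<rho> D \<union> raising \<Delta>) D" if "M \<in> raising \<Delta>" for M
    using that raising_app candidate_closed[OF A]
    by (blast intro: arrowI saturated_normalizing[OF saturated_raising])
  then show ?case by (auto simp: arrow_def)
next
  case (list_corr A \<Delta>)
  show ?case unfolding interp.simps by (rule lists_of_mono) auto
next
  case (list_mono A B)
  show ?case
    unfolding interp.simps by (rule lists_of_mono) (simp_all add: list_mono.IH list_mono.prems)
next
  case (corr_corr_left A \<Delta> \<Delta>')
  then show ?case by (simp add: ac_simps)
next
  case (corr_corr_right A \<Delta> \<Delta>')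
  then show ?case by (simp add: ac_simps)
next
  case (arr_corr_left A B \<Delta>)
  show ?case by (auto simp: arrow_def)
next
  case (arr_corr_right A \<Delta> B)
  show ?case
  proof
    fix M assume M: "M \<in> interp (A \<up> \<Delta> \<^bold>\<rightarrow> B \<up> \<Delta>) \<rho> D"
    have "M \<^bold>\<cdot> N \<in> interp B \<rho> D'" if "D |\<union>| \<Delta> |\<subseteq>| D'" "N \<in> interp A \<rho> D'" for D' N
    proof -
      have "D' |\<union>| \<Delta> = D'" using that by auto
      then show ?thesis
        using arrowD[OF M[unfolded interp.simps], of D' N] that by simp
    qed
    with M show "M \<in> interp ((A \<^bold>\<rightarrow> B) \<up> \<Delta>) \<rho> D"
      by (auto intro: arrowI dest: arrow_normalizing)
  qed
qed (auto simp: raising_union)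

section \<open>Realizability of the term constructors\<close>

lemma answer_arrowI:
  assumes "closed_trm V" and "answer V" and "\<And>D' N. D |\<subseteq>| D' \<Longrightarrow> N \<in> X D' \<Longrightarrow> V \<^bold>\<cdot> N \<in> Y D'"
  shows "V \<in> arrow X Y D"
  using assms normalizing_answer arrowI by metis

lemma answer_arrow3I:
  assumes F: "closed_trm F" "answer F" "\<And>x. answer (F \<^bold>\<cdot> x)" "\<And>x y. answer (F \<^bold>\<cdot> x \<^bold>\<cdot> y)"
    and X: "candidate X" and Y: "candidate Y"
    and main: "\<And>D1 D2 D3 x y z. D1 |\<subseteq>| D2 \<Longrightarrow> D2 |\<subseteq>| D3 \<Longrightarrow> x \<in> X D1 \<Longrightarrow> y \<in> Y D2 \<Longrightarrow> z \<in> N D3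
      \<Longrightarrow> F \<^bold>\<cdot> x \<^bold>\<cdot> y \<^bold>\<cdot> z \<in> Z D3"
  shows "F \<in> arrow X (arrow Y (arrow N Z)) D"
proof (rule answer_arrowI[OF F(1,2)])
  fix D1 x assume x: "x \<in> X D1"
  have clx: "closed_trm (F \<^bold>\<cdot> x)" using F(1) candidate_closed[OF X x] by simp
  show "F \<^bold>\<cdot> x \<in> arrow Y (arrow N Z) D1"
  proof (rule answer_arrowI[OF clx F(3)])
    fix D2 y assume D2: "D1 |\<subseteq>| D2" and y: "y \<in> Y D2"
    have cly: "closed_trm (F \<^bold>\<cdot> x \<^bold>\<cdot> y)" using clx candidate_closed[OF Y y] by simp
    show "F \<^bold>\<cdot> x \<^bold>\<cdot> y \<in> arrow N Z D2"
      by (rule answer_arrowI[OF cly F(4)]) (rule main[OF D2 _ x y])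
  qed
qed

lemma Try_realizes:
  assumes S: "saturated S" and M: "M \<in> S \<union> raising {|\<epsilon>|}" and N: "N \<in> S"
  shows "Try M \<epsilon> N \<in> S"
proof -
  have "normalizing M"
    using M S saturated_normalizing saturated_raising by blast
  then obtain V where clM: "closed_trm M" and V: "answer V" "M \<rightarrow>\<^sub>w\<^sup>* V"
    by (auto simp: normalizing_def)
  have clN: "closed_trm N"
    using N S saturated_normalizing normalizing_closed by blast
  have clV: "closed_trm V" using V(2) clM by (rule whrs_closed)
  have "V \<in> S \<or> V \<in> raising {|\<epsilon>|}"
    using M saturated_steps[OF V(2)] S saturated_raising clM by blast
  then have V': "V \<in> S \<or> V = Raise \<epsilon>"
    using V(1) by (auto simp: raising_def answer_no_step elim: converse_rtranclpE)
  have "Try M \<epsilon> N \<rightarrow>\<^sub>w\<^sup>* Try V \<epsilon> N"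
    by (rule whrs_map[OF V(2), of "\<lambda>M. Try M \<epsilon> N"]) (rule whr.try_body)
  moreover have "Try V \<epsilon> N \<in> S"
  proof (cases "value_form V")
    case True
    then have "Try V \<epsilon> N \<rightarrow>\<^sub>w V"
      using clV by (simp add: regular_value_def whr.try_value)
    moreover have "V \<in> S" using True V' by (auto simp: Raise_not_value)
    ultimately show ?thesis
      using saturated_step[OF S] clV clN by auto
  next
    case False
    then obtain \<epsilon>' where \<epsilon>': "V = Raise \<epsilon>'" using V(1) by (auto simp: answer_def)
    show ?thesis
    proof (cases "\<epsilon>' = \<epsilon>")
      case True
      then show ?thesis
        using saturated_step[OF S _ whr.try_raise[of \<epsilon> N]] clN N \<epsilon>' by auto
    next
      case False
      then show ?thesis
        using saturated_step[OF S _ whr.try_raise_other[of \<epsilon> \<epsilon>' N]] clN V' \<epsilon>' by auto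
    qed
  qed
  ultimately show ?thesis
    using saturated_steps[OF _ S] clM clN by auto
qed

lemma iterator_raising:
  assumes "F = Rec \<or> F = LFold" and "M \<in> raising D" and "closed_trm x" and "closed_trm y"
  shows "F \<^bold>\<cdot> x \<^bold>\<cdot> y \<^bold>\<cdot> M \<in> raising D"
proof -
  obtain \<epsilon> where M: "closed_trm M" "\<epsilon> |\<in>| D" "M \<rightarrow>\<^sub>w\<^sup>* Raise \<epsilon>"
    using assms(2) by (auto simp: raising_def)
  have "F \<^bold>\<cdot> x \<^bold>\<cdot> y \<^bold>\<cdot> M \<rightarrow>\<^sub>w\<^sup>* F \<^bold>\<cdot> x \<^bold>\<cdot> y \<^bold>\<cdot> Raise \<epsilon>"
    by (rule whrs_map[OF M(3), of "\<lambda>M. F \<^bold>\<cdot> x \<^bold>\<cdot> y \<^bold>\<cdot> M"])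
      (use assms(1) in \<open>auto intro: whr.rec_arg whr.fold_arg\<close>)
  moreover have "F \<^bold>\<cdot> x \<^bold>\<cdot> y \<^bold>\<cdot> Raise \<epsilon> \<rightarrow>\<^sub>w Raise \<epsilon>"
    using assms(1) by (auto intro: whr.rec_raise whr.fold_raise)
  ultimately have "F \<^bold>\<cdot> x \<^bold>\<cdot> y \<^bold>\<cdot> M \<rightarrow>\<^sub>w\<^sup>* Raise \<epsilon>" by (rule rtranclp.rtrancl_into_rtrancl)
  moreover have "closed_trm (F \<^bold>\<cdot> x \<^bold>\<cdot> y \<^bold>\<cdot> M)" using assms M(1) by auto
  ultimately show ?thesis using M(2) by (auto simp: raising_def)
qed

lemma Rec_realizes:
  assumes S: "saturated S" and D: "raising D \<subseteq> S"
    and x: "x \<in> S" and y: "closed_trm y"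
    and step: "\<And>n r. n \<in> nats D \<Longrightarrow> r \<in> S \<Longrightarrow> y \<^bold>\<cdot> n \<^bold>\<cdot> r \<in> S"
    and M: "M \<in> nats D"
  shows "Rec \<^bold>\<cdot> x \<^bold>\<cdot> y \<^bold>\<cdot> M \<in> S"
proof -
  have clx: "closed_trm x"
    using x S saturated_normalizing normalizing_closed by blast
  have expand: "Rec \<^bold>\<cdot> x \<^bold>\<cdot> y \<^bold>\<cdot> M \<in> S"
    if "closed_trm M" "M \<rightarrow>\<^sub>w\<^sup>* V" "Rec \<^bold>\<cdot> x \<^bold>\<cdot> y \<^bold>\<cdot> V \<rightarrow>\<^sub>w P" "P \<in> S" for M V P
  proof -
    have "Rec \<^bold>\<cdot> x \<^bold>\<cdot> y \<^bold>\<cdot> M \<rightarrow>\<^sub>w\<^sup>* Rec \<^bold>\<cdot> x \<^bold>\<cdot> y \<^bold>\<cdot> V"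
      by (rule whrs_map[OF that(2), of "\<lambda>M. Rec \<^bold>\<cdot> x \<^bold>\<cdot> y \<^bold>\<cdot> M"]) (rule whr.rec_arg)
    then have "Rec \<^bold>\<cdot> x \<^bold>\<cdot> y \<^bold>\<cdot> M \<rightarrow>\<^sub>w\<^sup>* P"
      using that(3) by (rule rtranclp.rtrancl_into_rtrancl)
    then show ?thesis
      using saturated_steps[OF _ S] that clx y by auto
  qed
  show ?thesis
    using M
  proof induction
    case (zero M)
    then show ?case using expand whr.rec_zero x by blast
  next
    case (succ M N)
    then show ?case using expand whr.rec_succ step by blast
  next
    case (raise M)
    then show ?case using iterator_raising[of Rec M D x y] clx y D by blast
  qed
qed

lemma LFold_realizes:
  assumes S: "saturated S" and D: "raising D \<subseteq> S"
    and x: "x \<in> S" and y: "closed_trm y"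
    and step: "\<And>e l r. e \<in> T \<Longrightarrow> l \<in> lists_of T D \<Longrightarrow> r \<in> S \<Longrightarrow> y \<^bold>\<cdot> e \<^bold>\<cdot> l \<^bold>\<cdot> r \<in> S"
    and M: "M \<in> lists_of T D"
  shows "LFold \<^bold>\<cdot> x \<^bold>\<cdot> y \<^bold>\<cdot> M \<in> S"
proof -
  have clx: "closed_trm x"
    using x S saturated_normalizing normalizing_closed by blast
  have expand: "LFold \<^bold>\<cdot> x \<^bold>\<cdot> y \<^bold>\<cdot> M \<in> S"
    if "closed_trm M" "M \<rightarrow>\<^sub>w\<^sup>* V" "LFold \<^bold>\<cdot> x \<^bold>\<cdot> y \<^bold>\<cdot> V \<rightarrow>\<^sub>w P" "P \<in> S" for M V P
  proof -
    have "LFold \<^bold>\<cdot> x \<^bold>\<cdot> y \<^bold>\<cdot> M \<rightarrow>\<^sub>w\<^sup>* LFold \<^bold>\<cdot> x \<^bold>\<cdot> y \<^bold>\<cdot> V"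
      by (rule whrs_map[OF that(2), of "\<lambda>M. LFold \<^bold>\<cdot> x \<^bold>\<cdot> y \<^bold>\<cdot> M"]) (rule whr.fold_arg)
    then have "LFold \<^bold>\<cdot> x \<^bold>\<cdot> y \<^bold>\<cdot> M \<rightarrow>\<^sub>w\<^sup>* P"
      using that(3) by (rule rtranclp.rtrancl_into_rtrancl)
    then show ?thesis
      using saturated_steps[OF _ S] that clx y by auto
  qed
  show ?thesis
    using M
  proof induction
    case (nil M)
    then show ?case using expand whr.fold_nil x by blast
  next
    case (cons M E L)
    then show ?case using expand whr.fold_cons step by blast
  next
    case (raise M)
    then show ?case using iterator_raising[of LFold M D x y] clx y D by blast
  qed
qed

lemma Rec_arrow:
  assumes X: "candidate X"
  shows "Rec \<in> arrow (\<lambda>D. X D \<union> raising \<Delta>)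
    (arrow (arrow (\<lambda>D. nats (D |\<union>| \<Delta>))
              (arrow (\<lambda>D. X D \<union> raising \<Delta>) (\<lambda>D. X D \<union> raising \<Delta>)))
      (arrow (\<lambda>D. nats (D |\<union>| \<Delta>) \<union> raising \<Delta>') (\<lambda>D. X D \<union> raising (\<Delta> |\<union>| \<Delta>')))) D"
    (is "_ \<in> arrow ?X (arrow ?Y (arrow ?N ?Z)) D")
proof -
  have cX: "candidate ?X" by (rule candidate_Un_raising[OF X])
  have cN: "candidate (\<lambda>D. nats (D |\<union>| \<Delta>))" by (rule candidate_corrupt[OF candidate_nats])
  have cY: "candidate ?Y" by (intro candidate_arrow cX cN)
  have main: "Rec \<^bold>\<cdot> x \<^bold>\<cdot> y \<^bold>\<cdot> n \<in> ?Z D3"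
    if D: "D1 |\<subseteq>| D2" "D2 |\<subseteq>| D3" and x: "x \<in> ?X D1" and y: "y \<in> ?Y D2" and n: "n \<in> ?N D3"
    for D1 D2 D3 x y n
  proof -
    have clx: "closed_trm x" and cly: "closed_trm y"
      using candidate_closed[OF cX x] candidate_closed[OF cY y] .
    show ?thesis
    proof (cases "n \<in> raising \<Delta>'")
      case True
      then show ?thesis
        using iterator_raising[of Rec n \<Delta>' x y] clx cly by (auto simp: raising_union)
    next
      case False
      have "Rec \<^bold>\<cdot> x \<^bold>\<cdot> y \<^bold>\<cdot> n \<in> ?X D3"
      proof (rule Rec_realizes[OF candidate_saturated[OF cX] _ _ cly])
        show "raising (D3 |\<union>| \<Delta>) \<subseteq> ?X D3"
          using candidate_raising[OF X] by (auto simp: raising_union)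
        show "x \<in> ?X D3"
          using x candidate_mono[OF cX, of D1 D3] D by blast
        show "y \<^bold>\<cdot> m \<^bold>\<cdot> r \<in> ?X D3" if "m \<in> nats (D3 |\<union>| \<Delta>)" "r \<in> ?X D3" for m r
          using arrowD[OF arrowD[OF y D(2) that(1)] order_refl that(2)] .
        show "n \<in> nats (D3 |\<union>| \<Delta>)" using n False by blast
      qed
      then show ?thesis by (auto simp: raising_union)
    qed
  qed
  show ?thesis
    by (rule answer_arrow3I[OF _ _ _ _ cX cY main]) auto
qed

lemma LFold_arrow:
  assumes X: "candidate X" and B: "candidate B"
  shows "LFold \<in> arrow (\<lambda>D. X D \<union> raising \<Delta>)
    (arrow (arrow (\<lambda>D. B (D |\<union>| \<Delta>)) (arrow (\<lambda>D. lists_of (B (D |\<union>| \<Delta>)) (D |\<union>| \<Delta>))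
              (arrow (\<lambda>D. X D \<union> raising \<Delta>) (\<lambda>D. X D \<union> raising \<Delta>))))
      (arrow (\<lambda>D. lists_of (B (D |\<union>| \<Delta>)) (D |\<union>| \<Delta>) \<union> raising \<Delta>')
        (\<lambda>D. X D \<union> raising (\<Delta> |\<union>| \<Delta>')))) D"
    (is "_ \<in> arrow ?X (arrow ?Y (arrow ?N ?Z)) D")
proof -
  have cX: "candidate ?X" by (rule candidate_Un_raising[OF X])
  have cB: "candidate (\<lambda>D. B (D |\<union>| \<Delta>))" by (rule candidate_corrupt[OF B])
  have cL: "candidate (\<lambda>D. lists_of (B (D |\<union>| \<Delta>)) (D |\<union>| \<Delta>))"
    by (rule candidate_corrupt[OF candidate_lists_of[OF B]])
  have cY: "candidate ?Y" by (intro candidate_arrow cX cB cL)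
  have main: "LFold \<^bold>\<cdot> x \<^bold>\<cdot> y \<^bold>\<cdot> n \<in> ?Z D3"
    if D: "D1 |\<subseteq>| D2" "D2 |\<subseteq>| D3" and x: "x \<in> ?X D1" and y: "y \<in> ?Y D2" and n: "n \<in> ?N D3"
    for D1 D2 D3 x y n
  proof -
    have clx: "closed_trm x" and cly: "closed_trm y"
      using candidate_closed[OF cX x] candidate_closed[OF cY y] .
    show ?thesis
    proof (cases "n \<in> raising \<Delta>'")
      case True
      then show ?thesis
        using iterator_raising[of LFold n \<Delta>' x y] clx cly by (auto simp: raising_union)
    next
      case False
      have "LFold \<^bold>\<cdot> x \<^bold>\<cdot> y \<^bold>\<cdot> n \<in> ?X D3"
      proof (rule LFold_realizes[OF candidate_saturated[OF cX] _ _ cly])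
        show "raising (D3 |\<union>| \<Delta>) \<subseteq> ?X D3"
          using candidate_raising[OF X] by (auto simp: raising_union)
        show "x \<in> ?X D3"
          using x candidate_mono[OF cX, of D1 D3] D by blast
        show "y \<^bold>\<cdot> e \<^bold>\<cdot> l \<^bold>\<cdot> r \<in> ?X D3"
          if "e \<in> B (D3 |\<union>| \<Delta>)" "l \<in> lists_of (B (D3 |\<union>| \<Delta>)) (D3 |\<union>| \<Delta>)" "r \<in> ?X D3" for e l r
          using arrowD[OF arrowD[OF arrowD[OF y D(2) that(1)] order_refl that(2)] order_refl that(3)] .
        show "n \<in> lists_of (B (D3 |\<union>| \<Delta>)) (D3 |\<union>| \<Delta>)" using n False by blast
      qed
      then show ?thesis by (auto simp: raising_union)
    qed
  qed
  show ?thesis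
    by (rule answer_arrow3I[OF _ _ _ _ cX cY main]) auto
qed

lemma Succ_arrow: "Succ \<in> arrow nats nats D"
proof (rule answer_arrowI)
  fix D' and N :: "'a trm" assume N: "N \<in> nats D'"
  have "closed_trm (Succ \<^bold>\<cdot> N)" using candidate_closed[OF candidate_nats N] by simp
  then show "Succ \<^bold>\<cdot> N \<in> nats D'" by (rule nats.succ[OF _ rtranclp.rtrancl_refl N])
qed auto

lemma LCons_arrow:
  assumes "candidate X"
  shows "LCons \<in> arrow X (arrow (\<lambda>D. lists_of (X D) D) (\<lambda>D. lists_of (X D) D)) D"
proof (intro answer_arrowI)
  fix D' e D'' l
  assume *: "e \<in> X D'" "D' |\<subseteq>| D''" "l \<in> lists_of (X D'') D''"
  have "e \<in> X D''" using * candidate_mono[OF assms] by blast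
  then show "LCons \<^bold>\<cdot> e \<^bold>\<cdot> l \<in> lists_of (X D'') D''"
    using * candidate_closed[OF assms] candidate_closed[OF candidate_lists_of[OF assms]]
    by (intro lists_of.cons[OF _ rtranclp.rtrancl_refl]) auto
qed (auto dest: candidate_closed[OF assms])

section \<open>Soundness of typing\<close>

theorem typing_sound:
  assumes "\<Gamma> \<turnstile> M : A" and "\<And>i. candidate (\<rho> i)" and "\<And>i. closed_trm (\<sigma> i)"
    and "\<And>i. i < length \<Gamma> \<Longrightarrow> \<sigma> i \<in> interp (\<Gamma> ! i) \<rho> D"
  shows "psubst \<sigma> 0 M \<in> interp A \<rho> D"
  using assms
proof (induction arbitrary: \<rho> \<sigma> D rule: typing.induct)
  case (lam A \<Gamma> M B)
  have A: "candidate (interp A \<rho>)" and B: "candidate (interp B \<rho>)"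
    using lam.prems(1) candidate_interp by blast+
  have cl: "closed_trm (Lam (psubst \<sigma> (Suc 0) M))"
    using closed_psubst[of \<sigma> "Lam M", OF lam.prems(2)] by simp
  show ?case
    unfolding psubst.simps interp.simps
  proof (rule answer_arrowI)
    fix D' N assume D': "D |\<subseteq>| D'" and N: "N \<in> interp A \<rho> D'"
    have clN: "closed_trm N" using candidate_closed[OF A N] .
    have mono: "interp C \<rho> D \<subseteq> interp C \<rho> D'" for C
      by (rule candidate_mono[OF candidate_interp D']) (rule lam.prems(1))
    have "psubst (case_nat N \<sigma>) 0 M \<in> interp B \<rho> D'"
    proof (rule lam.IH[OF lam.prems(1)])
      show "closed_trm (case i of 0 \<Rightarrow> N | Suc x \<Rightarrow> \<sigma> x)" for i
        using clN lam.prems(2) by (simp split: nat.split)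
      show "(case i of 0 \<Rightarrow> N | Suc x \<Rightarrow> \<sigma> x) \<in> interp ((A # \<Gamma>) ! i) \<rho> D'"
        if "i < length (A # \<Gamma>)" for i
        using that N lam.prems(3) mono by (auto split: nat.split)
    qed
    then have "subst (psubst \<sigma> (Suc 0) M) N 0 \<in> interp B \<rho> D'"
      using subst_psubst[OF lam.prems(2) clN] by simp
    then show "Lam (psubst \<sigma> (Suc 0) M) \<^bold>\<cdot> N \<in> interp B \<rho> D'"
      using saturated_step[OF candidate_saturated[OF B] _ whr.beta] cl clN by simp
  qed (use cl in auto)
next
  case (app \<Gamma> M A B N)
  have "psubst \<sigma> 0 M \<in> interp (A \<^bold>\<rightarrow> B) \<rho> D" and "psubst \<sigma> 0 N \<in> interp A \<rho> D"
    using app.IH app.prems by blast+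
  then show ?case using arrowD[of "psubst \<sigma> 0 M" _ _ D D] by simp
next
  case (gen \<Gamma> M A)
  show ?case
    unfolding mem_interp_TAll
  proof (intro allI impI)
    fix X :: "'a fset \<Rightarrow> 'a trm set" assume X: "candidate X"
    show "psubst \<sigma> 0 M \<in> interp A (shift 0 X \<rho>) D"
      by (rule gen.IH) (use gen.prems X in \<open>auto simp: candidate_shift interp_tlift\<close>)
  qed
next
  case (sub \<Gamma> M A B)
  have "interp A \<rho> D \<subseteq> interp B \<rho> D"
    by (rule subtype_sound[OF sub.hyps(2)]) (rule sub.prems(1))
  moreover have "psubst \<sigma> 0 M \<in> interp A \<rho> D"
    by (rule sub.IH) (rule sub.prems; assumption?)+
  ultimately show ?case by blast
next
  case (recursor \<Gamma> \<Delta> \<Delta>')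
  show ?case
    unfolding mem_interp_TAll using Rec_arrow by (auto simp: shift_def)
next
  case (cons \<Gamma>)
  show ?case
    unfolding mem_interp_TAll using LCons_arrow by (auto simp: shift_def)
next
  case (fold \<Gamma> \<Delta> \<Delta>')
  show ?case
    unfolding mem_interp_TAll using LFold_arrow by (auto simp: shift_def)
next
  case (raise \<Gamma> \<epsilon>)
  show ?case
    unfolding mem_interp_TAll by (auto simp: raising_def)
next
  case (try_with \<Gamma> M A \<epsilon> N)
  have "psubst \<sigma> 0 M \<in> interp A \<rho> D \<union> raising {|\<epsilon>|}" and "psubst \<sigma> 0 N \<in> interp A \<rho> D"
    using try_with.IH(1)[OF try_with.prems] try_with.IH(2)[OF try_with.prems] by simp_all
  then show ?case
    using Try_realizes[OF candidate_saturated[OF candidate_interp[OF try_with.prems(1)]]] by simp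
qed (auto intro: nats.zero lists_of.nil simp: Succ_arrow)

lemma nats_numeral: "M \<in> nats {||} \<Longrightarrow> \<exists>n. M \<longmapsto>\<^sup>* nat_trm n"
proof (induction rule: nats.induct)
  case (zero M)
  then have "M \<longmapsto>\<^sup>* nat_trm 0" by (simp add: nat_trm_def whrs_reds)
  then show ?case ..
next
  case (succ M N)
  then obtain n where n: "N \<longmapsto>\<^sup>* nat_trm n" by blast
  have "Succ \<^bold>\<cdot> N \<longmapsto>\<^sup>* Succ \<^bold>\<cdot> nat_trm n"
    using n by (induction rule: rtranclp_induct)
      (auto intro: rtranclp.rtrancl_into_rtrancl red.app_right)
  with whrs_reds[OF succ.hyps(2)] have "M \<longmapsto>\<^sup>* nat_trm (Suc n)"
    by (simp add: nat_trm_def)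
  then show ?case ..
qed (simp add: raising_def)

theorem lemma5p20:
  fixes M :: "'e::countable trm"
  assumes "[] \<turnstile> M : TNat"
  shows "\<exists>n::nat. M \<longmapsto>\<^sup>* nat_trm n"
proof -
  have "psubst (\<lambda>_. Zero) 0 M \<in> interp TNat (\<lambda>_. nats) {||}"
    using assms by (rule typing_sound) (auto simp: candidate_nats)
  then show ?thesis
    using nats_numeral psubst_fresh[of M 0] typing_fv[OF assms] by simp
qed

end
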